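(* Let $G$ be a graph with $n$ vertices and let $\lambda_1$ be the largest eigenvalue of the diminished Sombor matrix $\mathcal{M}=M_{DS}(G)$. Then $$2\lambda_1\leq E_{DSO}(G)\leq\lambda_1+\sqrt{(n-1)\left(\operatorname{tr}(\mathcal{M}^2)-\lambda_1^2\right)}.$$ Equality holds if and only if $G\cong K_n$.
   Context: All graphs are finite, simple and undirected. For a graph $G$ with vertices $v_1,\dots,v_n$ and degrees $d_i=d_{v_i}$, the diminished Sombor matrix $M_{DS}(G)=(\mu_{ij})$ is the $n\times n$ real symmetric matrix with $\mu_{ij}=\frac{\sqrt{d_i^2+d_j^2}}{d_i+d_j}$ if $v_iv_j\in E(G)$, and $\mu_{ij}=0$ otherwise. If $\lambda_1\geq\cdots\geq\lambda_n$ are its eigenvalues, the diminished Sombor energy is $E_{DSO}(G)=\sum_{i=1}^n|\lambda_i|$.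
   Formalization: "Equality holds" is read as equality in both inequalities (each alone fails: P_3 on the left, 2K_2 on the right), and edgeless graphs are added beside K_n, since for them all three quantities are 0. *)

theory Defs
  imports
    "Graph_Theory.Graph_Theory"
    "Jordan_Normal_Form.Char_Poly"
begin

text \<open>
  A finite simple undirected graph is a digraph satisfying \<^locale>\<open>graph\<close>: finite, symmetric,
  without loops and without multiple arcs.  The undirected edge \<open>uv\<close> is the pair of opposite arcs
  between \<open>u\<close> and \<open>v\<close>, so the degree of a vertex is its out-degree.  The list \<open>vs\<close> is the
  enumeration \<open>v\<^sub>1, \<dots>, v\<^sub>n\<close> of the vertices, indexed from 0.
\<close>

definition dso_matrix :: "('a, 'b) pre_digraph \<Rightarrow> 'a list \<Rightarrow> real mat" where
  "dso_matrix G vs = mat (length vs) (length vs) (\<lambda>(i, j).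
     if vs ! i \<rightarrow>\<^bsub>G\<^esub> vs ! j then
       sqrt ((real (out_degree G (vs ! i)))\<^sup>2 + (real (out_degree G (vs ! j)))\<^sup>2)
         / (real (out_degree G (vs ! i)) + real (out_degree G (vs ! j)))
     else 0)"

definition largest_eigenvalue :: "real mat \<Rightarrow> real" where
  "largest_eigenvalue A = Max {k. eigenvalue A k}"

text \<open>
  The multiset \<^term>\<open>proots (char_poly A)\<close> lists the real eigenvalues of \<open>A\<close> with algebraic
  multiplicity.  For a symmetric real matrix, such as \<^const>\<open>dso_matrix\<close> of a graph, these are all
  \<open>n\<close> eigenvalues.
\<close>

definition dso_energy :: "('a, 'b) pre_digraph \<Rightarrow> 'a list \<Rightarrow> real" where
  "dso_energy G vs = (\<Sum>k\<in>#proots (char_poly (dso_matrix G vs)). \<bar>k\<bar>)"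

definition mat_trace :: "'a :: comm_monoid_add mat \<Rightarrow> 'a" where
  "mat_trace A = (\<Sum>i<dim_row A. A $$ (i, i))"

end

theory Submission
  imports Defs "Jordan_Normal_Form.Schur_Decomposition"
begin

text \<open>
  The eigenvalues \<open>\<lambda>\<^sub>1 \<ge> \<dots> \<ge> \<lambda>\<^sub>n\<close> sum to \<open>tr M = 0\<close>, so \<open>\<bar>\<lambda>\<^sub>2\<bar> + \<dots> + \<bar>\<lambda>\<^sub>n\<bar> \<ge> \<lambda>\<^sub>1\<close>; the upper bound is
  the Cauchy-Schwarz inequality for \<open>\<lambda>\<^sub>2, \<dots>, \<lambda>\<^sub>n\<close>. If both are equalities, then
  \<open>\<lambda>\<^sub>2 = \<dots> = \<lambda>\<^sub>n = - \<mu>\<close> with \<open>\<lambda>\<^sub>1 = (n - 1) \<mu>\<close>. In that case \<open>N = M + \<mu> I\<close> satisfies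
  \<open>N\<^sup>2 = n \<mu> N\<close> and has constant diagonal \<open>\<mu>\<close>, which forces every entry of \<open>N\<close> to equal \<open>\<mu>\<close>:
  either \<open>\<mu> = 0\<close> and \<open>M = 0\<close>, or any two vertices are adjacent. That a symmetric matrix with
  spectrum \<open>{a, b}\<close> satisfies \<open>(M - a)(M - b) = 0\<close>, and conversely, is read off from the power traces
  \<open>tr M\<^sup>k = \<Sum> \<lambda>\<^sub>i\<^sup>k\<close> for \<open>k \<le> 4\<close>, without diagonalising \<open>M\<close>.
\<close>

section \<open>Real spectrum of a real symmetric matrix\<close>

text \<open>The Hermitian form \<open>S\<close> is fixed by conjugation because \<open>A\<close> is
  real symmetric, and it equals \<open>a\<close> times the nonzero real squared norm
  \<open>N\<close> of the eigenvector.\<close>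

lemma sym_eigenvalue_real:
  fixes A :: "real mat" and a :: complex
  assumes A: "A \<in> carrier_mat n n"
    and sym: "\<And>i j. i < n \<Longrightarrow> j < n \<Longrightarrow> A $$ (i, j) = A $$ (j, i)"
    and ev: "eigenvalue (map_mat of_real A) a"
  shows "a \<in> \<real>"
proof -
  from ev A obtain v where v: "v \<in> carrier_vec n" "v \<noteq> 0\<^sub>v n"
    and Av: "map_mat of_real A *\<^sub>v v = a \<cdot>\<^sub>v v"
    unfolding eigenvalue_def eigenvector_def by auto
  have row: "(\<Sum>j<n. of_real (A $$ (i, j)) * v $ j) = a * v $ i" if i: "i < n" for i
  proof -
    have "(map_mat of_real A *\<^sub>v v) $ i = (\<Sum>j<n. of_real (A $$ (i, j)) * v $ j)"
      using i A v by (auto simp: scalar_prod_def lessThan_atLeast0 intro!: sum.cong)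
    then show ?thesis using Av i v by simp
  qed
  define S where "S = (\<Sum>i<n. \<Sum>j<n. of_real (A $$ (i, j)) * v $ j * cnj (v $ i))"
  define N where "N = (\<Sum>i<n. (cmod (v $ i))\<^sup>2)"
  have "S = (\<Sum>i<n. a * v $ i * cnj (v $ i))"
    unfolding S_def by (intro sum.cong refl) (simp add: row flip: sum_distrib_right)
  also have "\<dots> = a * of_real N"
    unfolding N_def by (simp add: sum_distrib_left complex_norm_square mult.assoc del: of_real_power)
  finally have S: "S = a * of_real N" .
  have "cnj S = (\<Sum>i<n. \<Sum>j<n. of_real (A $$ (j, i)) * v $ i * cnj (v $ j))"
    unfolding S_def by (auto simp: sym ac_simps intro!: sum.cong)
  also have "\<dots> = S"
    unfolding S_def by (rule sum.swap)
  finally have "cnj a * of_real N = a * of_real N"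
    using S by simp
  moreover have "N \<noteq> 0"
  proof
    assume "N = 0"
    then have "\<forall>i<n. v $ i = 0"
      unfolding N_def by (auto simp: sum_nonneg_eq_0_iff)
    then show False using v by auto
  qed
  ultimately show ?thesis by (simp add: Reals_cnj_iff)
qed

text \<open>Over the complex numbers the polynomial splits; all roots are real, so the factorisation
  descends along the injective coefficient embedding.\<close>

lemma sym_char_poly_splits:
  fixes A :: "real mat"
  assumes A: "A \<in> carrier_mat n n"
    and sym: "\<And>i j. i < n \<Longrightarrow> j < n \<Longrightarrow> A $$ (i, j) = A $$ (j, i)"
  obtains es where "char_poly A = (\<Prod>e\<leftarrow>es. [:- e, 1:])" "length es = n"
proof -
  interpret hom: map_poly_inj_idom_hom complex_of_real ..
  let ?A = "map_mat complex_of_real A"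
  have A': "?A \<in> carrier_mat n n" using A by simp
  obtain as where as: "char_poly ?A = (\<Prod>a\<leftarrow>as. [:- a, 1:])" "length as = n"
    using char_poly_factorized[OF A'] by blast
  have "a \<in> \<real>" if "a \<in> set as" for a
  proof (rule sym_eigenvalue_real[OF A sym])
    show "eigenvalue ?A a"
      using that by (auto simp: eigenvalue_root_char_poly[OF A'] as poly_prod_list prod_list_zero_iff)
  qed
  then have re: "map (of_real \<circ> Re) as = as"
    by (simp add: map_idI)
  have "map_poly complex_of_real (char_poly A) = (\<Prod>a\<leftarrow>as. [:- a, 1:])"
    using as of_real_hom.char_poly_hom[OF A] by metis
  also have "\<dots> = (\<Prod>a\<leftarrow>map (of_real \<circ> Re) as. [:- a, 1:])"
    by (simp only: re)
  also have "\<dots> = map_poly complex_of_real (\<Prod>e\<leftarrow>map Re as. [:- e, 1:])"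
    by (induction as) (simp_all add: hom.hom_mult of_real_hom.map_poly_pCons_hom del: mult_pCons_left)
  finally have "char_poly A = (\<Prod>e\<leftarrow>map Re as. [:- e, 1:])"
    by (rule hom.injectivity)
  then show thesis using that[of "map Re as"] as by simp
qed

section \<open>Traces of powers as power sums of the eigenvalues\<close>

lemma mat_trace_mult:
  fixes A B :: "'a :: semiring_0 mat"
  assumes "A \<in> carrier_mat n m" "B \<in> carrier_mat m n"
  shows "mat_trace (A * B) = (\<Sum>i<n. \<Sum>j<m. A $$ (i, j) * B $$ (j, i))"
  using assms unfolding mat_trace_def
  by (auto simp: scalar_prod_def lessThan_atLeast0 intro!: sum.cong)

lemma mat_trace_mult_comm:
  fixes A B :: "'a :: comm_semiring_0 mat"
  assumes "A \<in> carrier_mat n m" "B \<in> carrier_mat m n"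
  shows "mat_trace (A * B) = mat_trace (B * A)"
  unfolding mat_trace_mult[OF assms] mat_trace_mult[OF assms(2,1)]
  by (subst sum.swap) (simp add: mult.commute)

lemma mat_trace_similar:
  fixes A B :: "'a :: comm_semiring_1 mat"
  assumes "similar_mat_wit A B P Q"
  shows "mat_trace A = mat_trace B"
proof -
  define n where "n = dim_row A"
  note w = similar_mat_witD[OF n_def assms]
  have "mat_trace A = mat_trace (P * (B * Q))"
    using w by (simp add: assoc_mult_mat[of P n n B n Q n])
  also have "\<dots> = mat_trace (B * Q * P)"
    using w by (intro mat_trace_mult_comm[of _ n n]) auto
  also have "B * Q * P = B"
    using w by (simp add: assoc_mult_mat[of B n n Q n P n])
  finally show ?thesis .
qed

lemma upper_triangular_mult:
  fixes B C :: "'a :: semiring_0 mat"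
  assumes B: "B \<in> carrier_mat n n" "upper_triangular B"
    and C: "C \<in> carrier_mat n n" "upper_triangular C"
  shows "upper_triangular (B * C)"
    and "i < n \<Longrightarrow> (B * C) $$ (i, i) = B $$ (i, i) * C $$ (i, i)"
proof -
  have ent: "(B * C) $$ (i, j) = (\<Sum>k<n. B $$ (i, k) * C $$ (k, j))" if "i < n" "j < n" for i j
    using that B C by (auto simp: scalar_prod_def lessThan_atLeast0 intro!: sum.cong)
  \<comment> \<open>Only terms with \<open>i\<close> \<le> \<open>k\<close> \<le> \<open>j\<close>
    survive: none below the diagonal, a single one on it.\<close>
  have z: "B $$ (i, k) * C $$ (k, j) = 0" if "i < n" "j < n" "k < n" "k < i \<or> j < k" for i j k
    using that B C upper_triangularD[of B k i] upper_triangularD[of C j k] by auto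
  show "upper_triangular (B * C)"
  proof (unfold upper_triangular_def, intro allI impI)
    fix i j assume "i < dim_row (B * C)" "j < i"
    then have "i < n" "j < n" "j < i" using B by auto
    then show "(B * C) $$ (i, j) = 0"
      by (auto simp: ent intro!: sum.neutral z)
  qed
  show "(B * C) $$ (i, i) = B $$ (i, i) * C $$ (i, i)" if i: "i < n"
  proof -
    have "(B * C) $$ (i, i) = (\<Sum>k\<in>{i}. B $$ (i, k) * C $$ (k, i))"
      unfolding ent[OF i i] using i by (intro sum.mono_neutral_right) (auto intro!: z)
    then show ?thesis by simp
  qed
qed

lemma upper_triangular_pow:
  fixes B :: "'a :: semiring_1 mat"
  assumes B: "B \<in> carrier_mat n n" "upper_triangular B"
  shows "upper_triangular (B ^\<^sub>m k) \<and> (\<forall>i<n. (B ^\<^sub>m k) $$ (i, i) = (B $$ (i, i)) ^ k)"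
proof (induction k)
  case 0
  then show ?case using B by (auto simp: upper_triangular_def)
next
  case (Suc k)
  then show ?case
    using upper_triangular_mult[of "B ^\<^sub>m k" n B] B pow_carrier_mat[OF B(1), of k]
    by (auto simp: power_commutes)
qed

text \<open>Schur triangularisation preserves traces of powers, and powers of a triangular matrix
  have the powers of its diagonal entries on the diagonal.\<close>

lemma mat_trace_pow:
  fixes A :: "'a :: conjugatable_ordered_field mat"
  assumes A: "A \<in> carrier_mat n n" and es: "char_poly A = (\<Prod>e\<leftarrow>es. [:- e, 1:])"
  shows "mat_trace (A ^\<^sub>m k) = (\<Sum>e\<leftarrow>es. e ^ k)"
proof -
  obtain B P Q where "schur_decomposition A es = (B, P, Q)"
    by (cases "schur_decomposition A es")
  with schur_decomposition[OF A es] have sim: "similar_mat_wit A B P Q"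
    and ut: "upper_triangular B" and diag: "diag_mat B = es"
    by auto
  have B: "B \<in> carrier_mat n n" using similar_mat_witD2[OF A sim] by blast
  have "mat_trace (A ^\<^sub>m k) = mat_trace (B ^\<^sub>m k)"
    by (rule mat_trace_similar[OF similar_mat_wit_pow[OF sim]])
  also have "\<dots> = (\<Sum>i<n. (B $$ (i, i)) ^ k)"
    unfolding mat_trace_def using upper_triangular_pow[OF B ut] B by auto
  also have "\<dots> = (\<Sum>e\<leftarrow>es. e ^ k)"
    using B unfolding diag[symmetric] diag_mat_def
    by (simp add: comp_def interv_sum_list_conv_sum_set_nat lessThan_atLeast0)
  finally show ?thesis .
qed

section \<open>Quadratic annihilating polynomials via traces\<close>

text \<open>The entrywise sum is the trace of \<open>((A - a)(A - b))\<^sup>2\<close>, so \<open>(A - a)(A - b) = 0\<close>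
  if and only if every eigenvalue is \<open>a\<close> or \<open>b\<close>.\<close>

lemma sym_quadratic_annihilator:
  fixes A :: "real mat" and a b :: real
  assumes A: "A \<in> carrier_mat n n"
    and sym: "\<And>i j. i < n \<Longrightarrow> j < n \<Longrightarrow> A $$ (i, j) = A $$ (j, i)"
    and es: "char_poly A = (\<Prod>e\<leftarrow>es. [:- e, 1:])" and len: "length es = n"
  shows "(\<Sum>i<n. \<Sum>j<n. ((A * A) $$ (i, j) - (a + b) * A $$ (i, j) + (if i = j then a * b else 0))\<^sup>2)
    = (\<Sum>e\<leftarrow>es. ((e - a) * (e - b))\<^sup>2)"
proof -
  define C where "C = A * A"
  have C: "C \<in> carrier_mat n n" using A by (simp add: C_def)
  have Csym: "C $$ (i, j) = C $$ (j, i)" if "i < n" "j < n" for i j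
    using that A unfolding C_def
    by (auto simp: scalar_prod_def sym intro!: sum.cong)
  have p1: "A ^\<^sub>m 1 = A" and p2: "A ^\<^sub>m 2 = C"
    using A by (simp_all add: C_def numeral_2_eq_2)
  have p3: "A ^\<^sub>m 3 = C * A" and p4: "A ^\<^sub>m 4 = C * C"
    using A by (simp_all add: C_def numeral_3_eq_3 numeral_Bit0 assoc_mult_mat[of _ n n _ n _ n])
  note tr = mat_trace_pow[OF A es]
  \<comment> \<open>By symmetry a trace of a product is an entrywise inner product, so the expanded
    sum of squares consists of power traces.\<close>
  have flip: "mat_trace (X * Y) = (\<Sum>i<n. \<Sum>j<n. X $$ (i, j) * Y $$ (i, j))"
    if "X \<in> carrier_mat n n" "Y \<in> carrier_mat n n"
      and "\<And>i j. i < n \<Longrightarrow> j < n \<Longrightarrow> Y $$ (i, j) = Y $$ (j, i)" for X Y :: "real mat"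
    unfolding mat_trace_mult[OF that(1,2)]
    by (intro sum.cong refl arg_cong2[where f = "(*)"] that(3)) auto
  have t1: "(\<Sum>i<n. A $$ (i, i)) = (\<Sum>e\<leftarrow>es. e)"
    using tr[of 1] A by (simp add: p1 mat_trace_def)
  have t2: "(\<Sum>i<n. \<Sum>j<n. A $$ (i, j) * A $$ (i, j)) = (\<Sum>e\<leftarrow>es. e ^ 2)"
    using tr[of 2] flip[OF A A sym] unfolding p2 C_def by simp
  have t2': "(\<Sum>i<n. C $$ (i, i)) = (\<Sum>e\<leftarrow>es. e ^ 2)"
    using tr[of 2] C by (simp add: p2 mat_trace_def)
  have t3: "(\<Sum>i<n. \<Sum>j<n. C $$ (i, j) * A $$ (i, j)) = (\<Sum>e\<leftarrow>es. e ^ 3)"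
    using tr[of 3] flip[OF C A sym] unfolding p3 by simp
  have t4: "(\<Sum>i<n. \<Sum>j<n. C $$ (i, j) * C $$ (i, j)) = (\<Sum>e\<leftarrow>es. e ^ 4)"
    using tr[of 4] flip[OF C C Csym] unfolding p4 by simp
  define s p where "s = a + b" and "p = a * b"
  have "(C $$ (i, j) - s * A $$ (i, j) + (if i = j then p else 0))\<^sup>2
    = C $$ (i, j) * C $$ (i, j) + s\<^sup>2 * (A $$ (i, j) * A $$ (i, j)) - 2 * s * (C $$ (i, j) * A $$ (i, j))
      + (if i = j then p\<^sup>2 + 2 * p * C $$ (i, j) - 2 * s * p * A $$ (i, j) else 0)" for i j
    by (simp add: power2_eq_square algebra_simps)
  then have "(\<Sum>i<n. \<Sum>j<n. (C $$ (i, j) - s * A $$ (i, j) + (if i = j then p else 0))\<^sup>2)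
    = (\<Sum>e\<leftarrow>es. e ^ 4) + s\<^sup>2 * (\<Sum>e\<leftarrow>es. e ^ 2) - 2 * s * (\<Sum>e\<leftarrow>es. e ^ 3)
      + (real (length es) * p\<^sup>2 + 2 * p * (\<Sum>e\<leftarrow>es. e ^ 2) - 2 * s * p * (\<Sum>e\<leftarrow>es. e))"
    by (simp add: sum.distrib sum_subtractf sum.delta len t1 t2 t2' t3 t4 flip: sum_distrib_left)
  \<comment> \<open>Termwise this is (e^2 - s e + p)^2 = ((e - a)(e - b))^2.\<close>
  also have "\<dots> = (\<Sum>e\<leftarrow>es. ((e - a) * (e - b))\<^sup>2)"
    unfolding s_def p_def
    by (induction es) (simp_all add: algebra_simps power2_eq_square power3_eq_cube power4_eq_xxxx)
  finally show ?thesis unfolding C_def s_def p_def .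
qed

section \<open>Cauchy-Schwarz with its equality case\<close>

text \<open>With \<open>c\<close> the length and \<open>d\<close> the sum of absolute values this is
  a variance cleared of denominators.\<close>

lemma sum_list_scaled_deviation:
  fixes c d :: real
  shows "(\<Sum>x\<leftarrow>xs. (c * \<bar>x\<bar> - d)\<^sup>2)
    = c\<^sup>2 * (\<Sum>x\<leftarrow>xs. x\<^sup>2) - 2 * c * d * (\<Sum>x\<leftarrow>xs. \<bar>x\<bar>) + real (length xs) * d\<^sup>2"
  by (induction xs) (simp_all add: power2_diff power_mult_distrib algebra_simps)

text \<open>The deviation sum is \<open>m * (m * Q - S^2)\<close>: its nonnegativity gives the
  inequality, its vanishing makes every deviation zero.\<close>

lemma sum_list_abs_Cauchy_Schwarz:
  fixes xs :: "real list"
  shows "(\<Sum>x\<leftarrow>xs. \<bar>x\<bar>)\<^sup>2 \<le> real (length xs) * (\<Sum>x\<leftarrow>xs. x\<^sup>2)"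
    and "(\<Sum>x\<leftarrow>xs. \<bar>x\<bar>)\<^sup>2 = real (length xs) * (\<Sum>x\<leftarrow>xs. x\<^sup>2) \<Longrightarrow> x \<in> set xs
      \<Longrightarrow> real (length xs) * \<bar>x\<bar> = (\<Sum>x\<leftarrow>xs. \<bar>x\<bar>)"
proof -
  define m S Q where "m = real (length xs)" and "S = (\<Sum>x\<leftarrow>xs. \<bar>x\<bar>)" and "Q = (\<Sum>x\<leftarrow>xs. x\<^sup>2)"
  have dev: "(\<Sum>x\<leftarrow>xs. (m * \<bar>x\<bar> - S)\<^sup>2) = m * (m * Q - S\<^sup>2)"
    unfolding sum_list_scaled_deviation m_def[symmetric] S_def[symmetric] Q_def[symmetric]
    by (simp add: power2_eq_square algebra_simps)
  have nn: "0 \<le> (\<Sum>x\<leftarrow>xs. (m * \<bar>x\<bar> - S)\<^sup>2)" by (intro sum_list_nonneg) auto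
  show "S\<^sup>2 \<le> m * Q"
  proof (cases "xs = []")
    case False
    then have "0 < m" by (simp add: m_def)
    with nn dev show ?thesis by (simp add: zero_le_mult_iff)
  qed (simp add: S_def m_def)
  show "m * \<bar>x\<bar> = S" if "S\<^sup>2 = m * Q" "x \<in> set xs"
  proof -
    have "(\<Sum>x\<leftarrow>xs. (m * \<bar>x\<bar> - S)\<^sup>2) = 0" using dev that by simp
    then have "\<forall>y\<in>set (map (\<lambda>x. (m * \<bar>x\<bar> - S)\<^sup>2) xs). y = 0"
      by (subst (asm) sum_list_nonneg_eq_0_iff) auto
    then show ?thesis using that by auto
  qed
qed

text \<open>Meant for the eigenvalues other than the largest. \<open>sum\<close> and
  \<open>lower\<close> make the nonnegative terms \<open>\<bar>x\<bar> + x\<close> sum to 0, so no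
  entry is positive; \<open>upper\<close> makes the absolute values equal.\<close>

lemma zero_sum_extremal:
  fixes xs :: "real list"
  assumes sum: "l + sum_list xs = 0"
    and lower: "l = (\<Sum>x\<leftarrow>xs. \<bar>x\<bar>)"
    and upper: "(\<Sum>x\<leftarrow>xs. \<bar>x\<bar>) = sqrt (real (length xs) * (\<Sum>x\<leftarrow>xs. x\<^sup>2))"
    and x: "x \<in> set xs"
  shows "real (length xs) * x = - l"
proof -
  have "(\<Sum>x\<leftarrow>xs. \<bar>x\<bar> + x) = 0"
    using sum lower by (simp add: sum_list_addf)
  then have "\<forall>y\<in>set (map (\<lambda>x. \<bar>x\<bar> + x) xs). y = 0"
    by (subst (asm) sum_list_nonneg_eq_0_iff) auto
  then have neg: "\<bar>x\<bar> = - x" using x by force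
  have "0 \<le> (\<Sum>x\<leftarrow>xs. x\<^sup>2)" by (intro sum_list_nonneg) auto
  then have "(\<Sum>x\<leftarrow>xs. \<bar>x\<bar>)\<^sup>2 = real (length xs) * (\<Sum>x\<leftarrow>xs. x\<^sup>2)"
    unfolding upper by simp
  from sum_list_abs_Cauchy_Schwarz(2)[OF this x] show ?thesis
    unfolding neg using lower by simp
qed

section \<open>Rank-one projections with constant diagonal\<close>

text \<open>The hypotheses say that the symmetric matrix \<open>N\<close> satisfies \<open>N\<^sup>2 = n\<mu>N\<close>, so \<open>N / (n\<mu>)\<close> is an
  orthogonal projection of trace 1.\<close>

lemma projection_entries_const:
  fixes N :: "nat \<Rightarrow> nat \<Rightarrow> real"
  assumes mu: "0 < \<mu>"
    and nonneg: "\<And>i j. i < n \<Longrightarrow> j < n \<Longrightarrow> 0 \<le> N i j"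
    and diag: "\<And>i. i < n \<Longrightarrow> N i i = \<mu>"
    and proj: "\<And>i j. i < n \<Longrightarrow> j < n \<Longrightarrow> (\<Sum>k<n. N i k * N j k) = real n * \<mu> * N i j"
    and i: "i < n" and j: "j < n"
  shows "N i j = \<mu>"
proof -
  have row: "(\<Sum>k<n. (N i k)\<^sup>2) = real n * \<mu>\<^sup>2" if "i < n" for i
    using proj[OF that that] diag[OF that] by (simp add: power2_eq_square)
  have le: "N i j \<le> \<mu>" if "i < n" "j < n" for i j
  proof -
    \<comment> \<open>The bound 2xy \<le> x^2 + y^2 is applied along rows \<open>i\<close> and
      \<open>j\<close>, whose squared norms agree.\<close>
    have "2 * (real n * \<mu> * N i j) = (\<Sum>k<n. 2 * (N i k * N j k))"
      using proj[OF that] by (simp flip: sum_distrib_left)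
    also have "\<dots> \<le> (\<Sum>k<n. (N i k)\<^sup>2 + (N j k)\<^sup>2)"
      by (intro sum_mono) (use sum_squares_bound in \<open>simp add: mult.assoc\<close>)
    also have "\<dots> = 2 * (real n * \<mu> * \<mu>)"
      using row that by (simp add: sum.distrib power2_eq_square)
    finally show ?thesis using mu that by simp
  qed
  \<comment> \<open>The squares of the \<open>n\<close> entries of a row are at most \<mu>^2 each
    and average to \<mu>^2, so all are extremal.\<close>
  have "(\<Sum>k<n. \<mu>\<^sup>2 - (N i k)\<^sup>2) = 0"
    using row[OF i] by (simp add: sum_subtractf)
  moreover have "0 \<le> \<mu>\<^sup>2 - (N i k)\<^sup>2" if "k \<in> {..<n}" for k
    using that le nonneg i by (simp add: power_mono)
  ultimately have "\<mu>\<^sup>2 - (N i j)\<^sup>2 = 0"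
    using j by (subst (asm) sum_nonneg_eq_0_iff) auto
  then show ?thesis using mu nonneg[OF i j] by simp
qed

section \<open>Root multisets and vertex degrees\<close>

lemma proots_prod_linear:
  fixes es :: "'a :: idom list"
  shows "proots (\<Prod>e\<leftarrow>es. [:- e, 1:]) = mset es"
proof (induction es)
  case (Cons e es)
  have "(\<Prod>e\<leftarrow>es. [:- e, 1:]) \<noteq> 0" by (auto simp: prod_list_zero_iff)
  then show ?case using Cons by (simp add: proots_mult del: mult_pCons_left)
qed simp

lemma eigenvalues_eq_set:
  fixes A :: "'a :: field mat"
  assumes "A \<in> carrier_mat n n" "char_poly A = (\<Prod>e\<leftarrow>es. [:- e, 1:])"
  shows "{k. eigenvalue A k} = set es"
  by (auto simp: eigenvalue_root_char_poly[OF assms(1)] assms(2) poly_prod_list prod_list_zero_iff)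

lemma (in graph) out_degree_complete:
  assumes "K\<^bsub>n\<^esub> G" "v \<in> verts G"
  shows "out_degree G v = n - 1"
proof -
  have ends: "arcs_ends G = {(u, w). (u, w) \<in> verts G \<times> verts G \<and> u \<noteq> w}"
    and n: "card (verts G) = n"
    using assms(1) by (auto simp: complete_digraph_def)
  \<comment> \<open>Without parallel arcs, counting arcs out of \<open>v\<close> is counting
    neighbours.\<close>
  have inj: "inj_on (head G) (out_arcs G v)"
    by (rule inj_onI) (auto intro!: no_multi_arcs simp: arc_to_ends_def)
  have "w \<in> head G ` out_arcs G v \<longleftrightarrow> (v, w) \<in> arcs_ends G" for w
    by (auto simp: arcs_ends_def arc_to_ends_def)
  then have "head G ` out_arcs G v = verts G - {v}"
    using assms(2) ends by auto
  then show ?thesis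
    using card_image[OF inj] n assms(2) by (simp add: out_degree_def)
qed

text \<open>Makes the denominator of an edge entry positive, so that the support of the matrix is
  the edge set.\<close>

lemma (in graph) out_degree_pos:
  assumes "u \<rightarrow>\<^bsub>G\<^esub> v"
  shows "0 < out_degree G u"
proof -
  from assms obtain e where "e \<in> out_arcs G u"
    by (auto simp: arcs_ends_def arc_to_ends_def)
  moreover have "finite (out_arcs G u)" by (rule finite_out_arcs)
  ultimately show ?thesis by (auto simp: out_degree_def card_gt_0_iff)
qed

text \<open>Equality means that both bounds are attained at once: the path on three vertices already
  attains the lower one alone. Edgeless graphs occur because all quantities vanish for the zero
  matrix.\<close>

theorem theorem4p1:
  fixes G :: "('a, 'b) pre_digraph" and vs :: "'a list" and n :: nat
    and M :: "real mat" and lambda1 :: real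
  assumes "graph G"
    and "verts G \<noteq> {}"
    and "distinct vs" and "set vs = verts G"
    and "n = card (verts G)"
    and "M = dso_matrix G vs"
    and "lambda1 = largest_eigenvalue M"
  shows "2 * lambda1 \<le> dso_energy G vs \<and>
         dso_energy G vs \<le> lambda1 + sqrt ((real n - 1) * (mat_trace (M ^\<^sub>m 2) - lambda1\<^sup>2)) \<and>
         ((2 * lambda1 = dso_energy G vs \<and>
          dso_energy G vs = lambda1 + sqrt ((real n - 1) * (mat_trace (M ^\<^sub>m 2) - lambda1\<^sup>2)))
          \<longleftrightarrow> (K\<^bsub>n\<^esub> G \<or> arcs G = {}))"
proof -
  interpret graph G by fact
  have n: "length vs = n" using assms distinct_card by metis
  have n0: "0 < n" using assms(2,5) by (simp add: card_gt_0_iff)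
  have M: "M \<in> carrier_mat n n" using n by (simp add: assms(6) dso_matrix_def)
  define d where "d i = real (out_degree G (vs ! i))" for i
  have ent: "M $$ (i, j) = (if vs ! i \<rightarrow>\<^bsub>G\<^esub> vs ! j then sqrt ((d i)\<^sup>2 + (d j)\<^sup>2) / (d i + d j) else 0)"
    if "i < n" "j < n" for i j
    using that n by (simp add: assms(6) dso_matrix_def d_def)
  have adj_sym: "u \<rightarrow>\<^bsub>G\<^esub> v \<longleftrightarrow> v \<rightarrow>\<^bsub>G\<^esub> u" for u v
    using graph_symmetric by blast
  have adj_vs: "vs ! i \<in> verts G" if "i < n" for i
    using that n assms(4) nth_mem by metis
  have sym: "M $$ (i, j) = M $$ (j, i)" if "i < n" "j < n" for i j
    using that adj_sym by (simp add: ent add.commute)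
  have nonneg: "0 \<le> M $$ (i, j)" if "i < n" "j < n" for i j
    using that by (simp add: ent d_def)
  have diag: "M $$ (i, i) = 0" if "i < n" for i
    using that adj_not_same by (auto simp: ent)
  have pos: "0 < M $$ (i, j) \<longleftrightarrow> vs ! i \<rightarrow>\<^bsub>G\<^esub> vs ! j" if "i < n" "j < n" for i j
  proof -
    have "0 < sqrt ((d i)\<^sup>2 + (d j)\<^sup>2) / (d i + d j)" if "vs ! i \<rightarrow>\<^bsub>G\<^esub> vs ! j"
    proof -
      have "0 < d i" "0 \<le> d j" using out_degree_pos[OF that] by (simp_all add: d_def)
      then show ?thesis by (simp add: add_pos_nonneg)
    qed
    then show ?thesis using that by (simp add: ent)
  qed

  \<comment> \<open>The eigenvalue list and the two bounds\<close>
  obtain es where es: "char_poly M = (\<Prod>e\<leftarrow>es. [:- e, 1:])" "length es = n"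
    using sym_char_poly_splits[OF M sym] by blast
  \<comment> \<open>\<open>remove1\<close> deletes one copy only, so a repeated largest eigenvalue
    stays in \<open>xs\<close>.\<close>
  define l xs where "l = lambda1" and "xs = remove1 l es"
  have ne: "set es \<noteq> {}" using es n0 by auto
  have l_Max: "l = Max (set es)"
    unfolding l_def assms(7) largest_eigenvalue_def eigenvalues_eq_set[OF M es(1)] ..
  then have l_mem: "l \<in> set es" using ne by simp
  have len: "real (length xs) = real n - 1"
    using l_mem n0 es by (simp add: xs_def length_remove1 of_nat_diff)
  have split: "(\<Sum>e\<leftarrow>es. f e) = f l + (\<Sum>x\<leftarrow>xs. f x)" for f :: "real \<Rightarrow> real"
    unfolding xs_def by (rule sum_list_map_remove1[OF l_mem])
  have E: "dso_energy G vs = (\<Sum>e\<leftarrow>es. \<bar>e\<bar>)"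
    unfolding dso_energy_def assms(6)[symmetric] es proots_prod_linear
    by (simp flip: mset_map add: sum_mset_sum_list)
  have T: "mat_trace (M ^\<^sub>m 2) = (\<Sum>e\<leftarrow>es. e\<^sup>2)"
    by (rule mat_trace_pow[OF M es(1)])
  have sum0: "sum_list es = 0"
    using mat_trace_pow[OF M es(1), of 1] M diag by (simp add: mat_trace_def)
  have sum0': "l + sum_list xs = 0"
    using sum0 split[of "\<lambda>x. x"] by simp
  \<comment> \<open>The maximum is at least the average, which is 0.\<close>
  have l0: "0 \<le> l"
  proof -
    have "(\<Sum>e\<leftarrow>es. e) \<le> (\<Sum>e\<leftarrow>es. l)"
      by (intro sum_list_mono) (simp add: l_Max)
    then have "0 \<le> real n * l" using sum0 es by (simp add: sum_list_triv)
    then show ?thesis using n0 by (simp add: zero_le_mult_iff)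
  qed
  have E': "dso_energy G vs = l + (\<Sum>x\<leftarrow>xs. \<bar>x\<bar>)"
    using E split[of abs] l0 by simp
  have T': "mat_trace (M ^\<^sub>m 2) - l\<^sup>2 = (\<Sum>x\<leftarrow>xs. x\<^sup>2)"
    using T split[of "\<lambda>x. x\<^sup>2"] by simp
  have lower: "2 * l \<le> dso_energy G vs"
    using sum_list_abs[of xs] sum0' l0 unfolding E' by linarith
  have upper: "dso_energy G vs \<le> l + sqrt ((real n - 1) * (mat_trace (M ^\<^sub>m 2) - l\<^sup>2))"
    unfolding E' T' using sum_list_abs_Cauchy_Schwarz(1)[of xs]
    by (simp add: len real_le_rsqrt)

  \<comment> \<open>Both equalities force a complete or edgeless graph\<close>
  have "K\<^bsub>n\<^esub> G \<or> arcs G = {}"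
    if eq: "2 * l = dso_energy G vs"
      "dso_energy G vs = l + sqrt ((real n - 1) * (mat_trace (M ^\<^sub>m 2) - l\<^sup>2))"
  proof -
    have l_sum: "l = (\<Sum>x\<leftarrow>xs. \<bar>x\<bar>)" using eq(1) E' by simp
    have const: "(real n - 1) * x = - l" if "x \<in> set xs" for x
      using zero_sum_extremal[OF sum0' l_sum _ that] eq(2) unfolding E' T' len by simp
    \<comment> \<open>For \<open>n = 1\<close> this is division by zero, giving 0;
      \<open>l_mu\<close> still holds there, since \<open>l\<close> is an empty sum.\<close>
    define \<mu> where "\<mu> = l / (real n - 1)"
    have l_mu: "l = (real n - 1) * \<mu>"
    proof (cases "n = 1")
      case True
      then have "xs = []" using len by simp
      with l_sum True show ?thesis by simp
    qed (use n0 in \<open>simp add: \<mu>_def\<close>)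
    have mu0: "0 \<le> \<mu>" using l0 n0 by (simp add: \<mu>_def)
    have roots: "(e - l) * (e - (- \<mu>)) = 0" if "e \<in> set es" for e
    proof (cases "e = l")
      case False
      then have x: "e \<in> set xs" using that by (simp add: xs_def in_set_remove1)
      then have "real n - 1 \<noteq> 0" unfolding len[symmetric] by auto
      with const[OF x] have "e = - \<mu>" unfolding \<mu>_def by (simp add: field_simps)
      then show ?thesis by simp
    qed simp
    then have "map (\<lambda>e. ((e - l) * (e - (- \<mu>)))\<^sup>2) es = map (\<lambda>_. 0) es"
      by (intro map_cong refl) simp
    then have "(\<Sum>e\<leftarrow>es. ((e - l) * (e - (- \<mu>)))\<^sup>2) = 0"
      by (simp only: sum_list_0)
    then have "(\<Sum>i<n. \<Sum>j<n. ((M * M) $$ (i, j) - (l + - \<mu>) * M $$ (i, j)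
        + (if i = j then l * - \<mu> else 0))\<^sup>2) = 0"
      using sym_quadratic_annihilator[OF M sym es, of l "- \<mu>"] by simp
    then have entry: "(M * M) $$ (i, j) - (l + - \<mu>) * M $$ (i, j) + (if i = j then l * - \<mu> else 0) = 0"
      if "i < n" "j < n" for i j
      using that by (simp add: sum_nonneg_eq_0_iff sum_nonneg)
    \<comment> \<open>The square of \<open>M\<close>, rewritten by symmetry as inner products of
      rows.\<close>
    have quad: "(\<Sum>k<n. M $$ (i, k) * M $$ (j, k))
        = (l - \<mu>) * M $$ (i, j) + (if i = j then l * \<mu> else 0)" if "i < n" "j < n" for i j
    proof -
      have "(M * M) $$ (i, j) = (\<Sum>k<n. M $$ (i, k) * M $$ (j, k))"
        using that M by (auto simp: scalar_prod_def lessThan_atLeast0 sym[of j] intro!: sum.cong)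
      then show ?thesis
        using entry[OF that] by (auto split: if_splits)
    qed
    show ?thesis
    proof (cases "\<mu> = 0")
      case True
      \<comment> \<open>Here \<open>l\<close> = 0 too, so the diagonal case of \<open>quad\<close>
        says that each row has norm 0.\<close>
      have "M $$ (i, j) = 0" if "i < n" "j < n" for i j
        using quad[of i i] that True l_mu by (simp add: sum_nonneg_eq_0_iff)
      then have no_adj: "\<not> vs ! i \<rightarrow>\<^bsub>G\<^esub> vs ! j" if "i < n" "j < n" for i j
        using pos that by fastforce
      have "arcs G = {}"
      proof (rule ccontr)
        assume "arcs G \<noteq> {}"
        then obtain e where e: "e \<in> arcs G" by blast
        then have "tail G e \<rightarrow>\<^bsub>G\<^esub> head G e" by (auto simp: arcs_ends_def arc_to_ends_def)
        moreover have "tail G e \<in> set vs" "head G e \<in> set vs" using e assms(4) by auto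
        ultimately show False using no_adj n by (metis in_set_conv_nth)
      qed
      then show ?thesis ..
    next
      case False
      then have mu: "0 < \<mu>" using mu0 by simp
      define N where "N i j = M $$ (i, j) + (if i = j then \<mu> else 0)" for i j
      have const: "N i j = \<mu>" if "i < n" "j < n" for i j
      proof (rule projection_entries_const[OF mu _ _ _ that])
        fix i j assume ij: "i < n" "j < n"
        show "0 \<le> N i j" using nonneg[OF ij] mu by (simp add: N_def)
        \<comment> \<open>The diagonal shifts are written as indicators of \<open>k\<close>; after
          summation, \<open>l + \<mu>\<close> is \<open>n\<close> times \<mu> by
          \<open>l_mu\<close>.\<close>
        have "(\<Sum>k<n. N i k * N j k) = (\<Sum>k<n. M $$ (i, k) * M $$ (j, k)
            + (if k = i then \<mu> * M $$ (j, k) else 0) + (if k = j then \<mu> * M $$ (i, k) else 0)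
            + (if k = i then if i = j then \<mu>\<^sup>2 else 0 else 0))"
          by (intro sum.cong) (auto simp: N_def algebra_simps power2_eq_square)
        also have "\<dots> = (l + \<mu>) * M $$ (i, j) + (if i = j then l * \<mu> + \<mu>\<^sup>2 else 0)"
          using ij sym[OF ij] by (simp add: sum.distrib quad algebra_simps)
        also have "\<dots> = real n * \<mu> * N i j"
          unfolding l_mu N_def by (simp add: algebra_simps power2_eq_square)
        finally show "(\<Sum>k<n. N i k * N j k) = real n * \<mu> * N i j" .
      qed (simp add: N_def diag)
      have adj: "vs ! i \<rightarrow>\<^bsub>G\<^esub> vs ! j" if "i < n" "j < n" "i \<noteq> j" for i j
        using const[OF that(1,2)] mu pos[OF that(1,2)] that(3) by (simp add: N_def)
      have "u \<rightarrow>\<^bsub>G\<^esub> v" if "u \<in> verts G" "v \<in> verts G" "u \<noteq> v" for u v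
        using that adj n unfolding assms(4)[symmetric] by (metis in_set_conv_nth)
      then have "arcs_ends G = {(u, v). (u, v) \<in> verts G \<times> verts G \<and> u \<noteq> v}"
        using adj_in_verts adj_not_same by blast
      then show ?thesis
        using assms(1,5) by (simp add: complete_digraph_def)
    qed
  qed

  \<comment> \<open>Edgeless and complete graphs attain both bounds\<close>
  moreover have "2 * l = dso_energy G vs \<and>
      dso_energy G vs = l + sqrt ((real n - 1) * (mat_trace (M ^\<^sub>m 2) - l\<^sup>2))" if "arcs G = {}"
  proof -
    have "M $$ (i, j) = 0" if "i < n" "j < n" for i j
      using ent[OF that] \<open>arcs G = {}\<close> by (simp add: arcs_ends_def)
    then have "mat_trace (M ^\<^sub>m 2) = 0"
      using M by (simp add: numeral_2_eq_2 mat_trace_mult[of _ n n])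
    \<comment> \<open>The trace is the sum of the squared eigenvalues, so they all vanish.\<close>
    then have "\<forall>y\<in>set (map power2 es). y = 0"
      unfolding T by (subst (asm) sum_list_nonneg_eq_0_iff) auto
    then have z: "e = 0" if "e \<in> set es" for e using that by auto
    have "map abs es = map (\<lambda>_. 0) es" using z by simp
    then have "dso_energy G vs = 0" unfolding E by (simp only: sum_list_0)
    then show ?thesis using z[OF l_mem] \<open>mat_trace (M ^\<^sub>m 2) = 0\<close> by simp
  qed
  moreover have "2 * l = dso_energy G vs \<and>
      dso_energy G vs = l + sqrt ((real n - 1) * (mat_trace (M ^\<^sub>m 2) - l\<^sup>2))" if K: "K\<^bsub>n\<^esub> G"
  proof -
    \<comment> \<open>All degrees are equal, so every edge entry is sqrt(2 m^2) / (2 m), and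
      \<open>M\<close> is \<open>c\<close> times the all-ones matrix minus the identity.\<close>
    define c :: real where "c = sqrt 2 / 2"
    have c: "0 < c" by (simp add: c_def)
    have frac: "sqrt (m\<^sup>2 + m\<^sup>2) / (m + m) = c" if "0 < m" for m :: real
      using that by (simp add: c_def real_sqrt_mult flip: mult_2)
    have entK: "M $$ (i, j) = (if i = j then 0 else c)" if "i < n" "j < n" for i j
    proof (cases "i = j")
      case False
      have "vs ! i \<noteq> vs ! j" using False that n assms(3) by (simp add: nth_eq_iff_index_eq)
      then have "vs ! i \<rightarrow>\<^bsub>G\<^esub> vs ! j"
        using K that adj_vs by (simp add: complete_digraph_def)
      moreover have "d j = d i" "0 < d i"
        using out_degree_complete[OF K] adj_vs that False by (simp_all add: d_def)
      ultimately show ?thesis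
        using that False frac[of "d i"] by (simp add: ent)
    qed (use that diag in simp)
    have MM: "(M * M) $$ (i, j) = (if i = j then (real n - 1) * c\<^sup>2 else (real n - 2) * c\<^sup>2)"
      if "i < n" "j < n" for i j
    proof -
      have "(M * M) $$ (i, j) = (\<Sum>k<n. M $$ (i, k) * M $$ (k, j))"
        using that M by (auto simp: scalar_prod_def lessThan_atLeast0 intro!: sum.cong)
      \<comment> \<open>The last term repairs the double subtraction when
        \<open>i = j\<close>.\<close>
      also have "\<dots> = (\<Sum>k<n. c\<^sup>2 - (if k = i then c\<^sup>2 else 0) - (if k = j then c\<^sup>2 else 0)
          + (if k = i then if i = j then c\<^sup>2 else 0 else 0))"
        using that by (intro sum.cong) (auto simp: entK power2_eq_square)
      also have "\<dots> = (if i = j then (real n - 1) * c\<^sup>2 else (real n - 2) * c\<^sup>2)"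
        using that by (simp add: sum.distrib sum_subtractf algebra_simps)
      finally show ?thesis .
    qed
    \<comment> \<open>The expected eigenvalue on the all-ones vector; the other one is
      \<open>- c\<close>.\<close>
    define a where "a = (real n - 1) * c"
    have "(\<Sum>i<n. \<Sum>j<n. ((M * M) $$ (i, j) - (a + - c) * M $$ (i, j)
        + (if i = j then a * - c else 0))\<^sup>2) = 0"
      unfolding a_def
      by (intro sum.neutral ballI) (auto simp: MM entK algebra_simps power2_eq_square)
    then have "(\<Sum>e\<leftarrow>es. ((e - a) * (e - (- c)))\<^sup>2) = 0"
      by (simp only: sym_quadratic_annihilator[OF M sym es])
    then have "\<forall>y\<in>set (map (\<lambda>e. ((e - a) * (e - (- c)))\<^sup>2) es). y = 0"
      by (subst (asm) sum_list_nonneg_eq_0_iff) auto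
    then have roots: "e = a \<or> e = - c" if "e \<in> set es" for e using that by auto
    have l: "l = a" using roots[OF l_mem] l0 c by auto
    have a0: "0 \<le> a" using c n0 by (simp add: a_def)
    \<comment> \<open>No multiplicities are needed: on the two values \<open>a\<close> and
      \<open>- c\<close> the absolute value agrees with an affine function of \<open>e\<close>,
      whose sum is known because the eigenvalues sum to 0.\<close>
    have "real n * (\<Sum>e\<leftarrow>es. \<bar>e\<bar>) = (\<Sum>e\<leftarrow>es. real n * \<bar>e\<bar>)"
      by (simp add: sum_list_const_mult)
    also have "\<dots> = (\<Sum>e\<leftarrow>es. (real n - 2) * e + 2 * a)"
    proof (intro arg_cong[where f = sum_list] map_cong refl)
      fix e assume "e \<in> set es"
      then consider "\<bar>e\<bar> = a" "e = a" | "\<bar>e\<bar> = c" "e = - c"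
        using roots a0 c by fastforce
      then show "real n * \<bar>e\<bar> = (real n - 2) * e + 2 * a"
        by cases (simp_all only: a_def, simp_all add: algebra_simps)
    qed
    also have "\<dots> = real n * (2 * a)"
      using sum0 es by (simp add: sum_list_addf sum_list_const_mult sum_list_triv)
    finally have Ea: "dso_energy G vs = 2 * a" using n0 E by simp
    \<comment> \<open>Likewise, (e - a)(e + c) = 0 makes the square affine in
      \<open>e\<close>.\<close>
    have "mat_trace (M ^\<^sub>m 2) = (\<Sum>e\<leftarrow>es. (a - c) * e + a * c)"
      unfolding T
    proof (intro arg_cong[where f = sum_list] map_cong refl)
      fix e assume "e \<in> set es"
      from roots[OF this] show "e\<^sup>2 = (a - c) * e + a * c"
        by (auto simp: algebra_simps power2_eq_square)
    qed
    also have "\<dots> = real n * (a * c)"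
      using sum0 es by (simp add: sum_list_addf sum_list_const_mult sum_list_triv)
    finally have "(real n - 1) * (mat_trace (M ^\<^sub>m 2) - l\<^sup>2) = (real n - 1) * (real n * (a * c) - a\<^sup>2)"
      by (simp only: l)
    also have "\<dots> = a\<^sup>2"
      by (simp add: a_def algebra_simps power2_eq_square)
    finally show ?thesis using Ea l a0 by simp
  qed
  ultimately show ?thesis using lower upper unfolding l_def by blast
qed

end
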